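(* Let $\mu$ be a measure on $\omega$ (i.e. $\mu(A)=\sum_{n\in A}\mu(\{n\})$ with $\mu(\{n\})\in[0,\infty)$) such that $\mu(\omega)=\infty$ and $\mu(\{n\})\to0$. Let $\mathcal{F}$ be a hereditary family of finite subsets of $\omega$ and fix $\varepsilon>0$. If for every finite $E\subseteq\omega$ there is $F\in\mathcal{F}$ with $F\subseteq E$ and $\mu(F)\ge\varepsilon\mu(E)$, then $\mathcal{F}$ is not compact (as a subset of $\mathcal{P}(\omega)\cong2^\omega$).
   Context: A family $\mathcal{F}$ of subsets of $\omega$ is hereditary if $A\subseteq B\in\mathcal{F}$ implies $A\in\mathcal{F}$. *)

theory Defs
  imports "HOL-Analysis.Analysis"
begin

definition hereditary :: "nat set set \<Rightarrow> bool" where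
  "hereditary \<F> \<longleftrightarrow> (\<forall>A B. A \<subseteq> B \<longrightarrow> B \<in> \<F> \<longrightarrow> A \<in> \<F>)"

text \<open>
  The topology on the power set of \<open>\<omega>\<close> is transported from the product topology on \<open>2\<^sup>\<omega>\<close>,
  with \<open>2\<close> discrete, along the bijection sending a set to its characteristic function.
\<close>

definition powerset_topology :: "nat set topology" where
  "powerset_topology =
     pullback_topology UNIV (\<lambda>A n. n \<in> A)
       (product_topology (\<lambda>_. discrete_topology (UNIV :: bool set)) (UNIV :: nat set))"

text \<open>
  On a countable space in which every set is measurable, countable additivity already gives
  \<open>\<mu>(A) = \<Sum>\<^bsub>n \<in> A\<^esub> \<mu>({n})\<close> (see \<open>emeasure_countable_singleton\<close>), so only finiteness of the
  point masses has to be required.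
\<close>

definition measure_on_omega :: "nat measure \<Rightarrow> bool" where
  "measure_on_omega \<mu> \<longleftrightarrow> sets \<mu> = UNIV \<and> (\<forall>n. emeasure \<mu> {n} < \<infinity>)"

end

theory Submission
  imports Defs
begin

text \<open>
  Compactness makes the tree of members of \<open>\<F>\<close>, ordered by adding one point, well-founded.
  Call a family evadable if, at every scale \<open>c\<close> and arbitrarily far out, there is a finite set of
  mass about \<open>c\<close> that no member of the family meets in more than a prescribed small mass; the
  hypotheses on \<open>\<mu>\<close> make the empty family evadable.
  By well-founded induction on \<open>s\<close>, evadability survives adding the family of all \<open>F\<close> with
  \<open>s \<union> F \<in> \<F>\<close>: take \<open>k\<close> disjoint blocks of equal mass, each one evading the families of
  \<open>s \<union> {n}\<close> for all \<open>n\<close> in earlier blocks. Such an \<open>F\<close> meets only the first block it touches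
  substantially. For \<open>s = {}\<close> this shows that \<open>\<F>\<close> is evadable.
\<close>

section \<open>Evadable families\<close>

text \<open>The parameter \<open>m\<close> lets successive blocks be chosen disjoint, and the upper
  bound \<open>2 * c\<close> caps the loss on the one block that a set may meet
  substantially.\<close>

definition evadable :: "(nat \<Rightarrow> real) \<Rightarrow> nat set set \<Rightarrow> bool" where
  "evadable w \<U> \<longleftrightarrow> (\<forall>c>0. \<forall>\<delta>>0. \<forall>m. \<exists>E. finite E \<and> E \<subseteq> {m..} \<and>
     c \<le> sum w E \<and> sum w E \<le> 2 * c \<and> (\<forall>F\<in>\<U>. sum w (F \<inter> E) \<le> \<delta>))"

lemma evadableE:
  assumes "evadable w \<U>" "c > 0" "\<delta> > 0"
  obtains E where "finite E" "E \<subseteq> {m..}" "c \<le> sum w E" "sum w E \<le> 2 * c"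
    "\<And>F. F \<in> \<U> \<Longrightarrow> sum w (F \<inter> E) \<le> \<delta>"
proof -
  have "\<exists>E. finite E \<and> E \<subseteq> {m..} \<and> c \<le> sum w E \<and> sum w E \<le> 2 * c \<and> (\<forall>F\<in>\<U>. sum w (F \<inter> E) \<le> \<delta>)"
    using assms unfolding evadable_def by simp
  then show thesis
    using that by (elim exE conjE) simp
qed

text \<open>Start so far out that every weight is below \<open>c\<close> and add consecutive points
  until the mass first reaches \<open>c\<close>, which divergence guarantees. Before the last point
  the mass was below \<open>c\<close>, so it ends below \<open>2 * c\<close>.\<close>

lemma evadable_empty:
  fixes w :: "nat \<Rightarrow> real"
  assumes nonneg: "\<And>n. 0 \<le> w n" and null: "w \<longlonglongrightarrow> 0" and div: "\<not> summable w"
  shows "evadable w {}"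
  unfolding evadable_def
proof (intro allI impI)
  fix c \<delta> :: real and m :: nat
  assume c: "c > 0"
  from order_tendstoD(2)[OF null c] obtain M where M: "\<And>n. n \<ge> M \<Longrightarrow> w n < c"
    by (auto simp: eventually_sequentially)
  define N where "N = max m M"
  have "\<exists>k. c \<le> (\<Sum>i<k. w (i + N))"
  proof (rule ccontr)
    assume "\<nexists>k. c \<le> (\<Sum>i<k. w (i + N))"
    then have "summable (\<lambda>i. w (i + N))"
      by (intro bounded_imp_summable[where B = c])
        (auto simp: nonneg not_le intro: less_imp_le simp del: sum.lessThan_Suc simp flip: lessThan_Suc_atMost)
    then show False
      using div by (simp add: summable_iff_shift)
  qed
  moreover define k where "k = (LEAST k. c \<le> (\<Sum>i<k. w (i + N)))"
  ultimately have k: "c \<le> (\<Sum>i<k. w (i + N))"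
    by (metis LeastI_ex)
  with c obtain j where j: "k = Suc j"
    by (cases k) auto
  have "(\<Sum>i<j. w (i + N)) < c"
    using not_less_Least[of j "\<lambda>k. c \<le> (\<Sum>i<k. w (i + N))"] j by (simp add: k_def not_le)
  moreover have "w (j + N) < c"
    by (rule M) (simp add: N_def)
  ultimately have le: "(\<Sum>i<k. w (i + N)) \<le> 2 * c"
    by (simp add: j)
  let ?E = "(\<lambda>i. i + N) ` {..<k}"
  have "sum w ?E = (\<Sum>i<k. w (i + N))"
    by (subst sum.reindex) (auto simp: inj_on_def)
  with k le show "\<exists>E. finite E \<and> E \<subseteq> {m..} \<and> c \<le> sum w E \<and> sum w E \<le> 2 * c \<and>
      (\<forall>F\<in>{}. sum w (F \<inter> E) \<le> \<delta>)"
    by (intro exI[of _ ?E]) (auto simp: N_def)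
qed

text \<open>Families that are evadable separately may be evaded only by different sets, so their
  union can fail to be evadable. Hence each \<open>T i\<close> is assumed adjoinable to every
  evadable family, and they are adjoined one after another.\<close>

lemma evadable_Un_UN:
  assumes "finite I" "evadable w \<U>"
    and "\<And>i \<V>. i \<in> I \<Longrightarrow> evadable w \<V> \<Longrightarrow> evadable w (\<V> \<union> T i)"
  shows "evadable w (\<U> \<union> (\<Union>i\<in>I. T i))"
  using assms
proof (induction I rule: finite_induct)
  case empty
  from empty.prems(1) show ?case
    by simp
next
  case (insert i I)
  then have "evadable w ((\<U> \<union> (\<Union>i\<in>I. T i)) \<union> T i)"
    by auto
  then show ?case
    by (simp add: Un_ac)
qed

lemma evadable_Un_extensions:
  fixes w :: "nat \<Rightarrow> real"
  assumes nonneg: "\<And>n. 0 \<le> w n" and "finite s" and U: "evadable w \<U>"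
    and step: "\<And>n \<V>. n \<notin> s \<Longrightarrow> evadable w \<V> \<Longrightarrow> evadable w (\<V> \<union> {F. insert n s \<union> F \<in> \<F>})"
  shows "evadable w (\<U> \<union> {F. s \<union> F \<in> \<F>})"
  unfolding evadable_def
proof (intro allI impI)
  fix c \<delta> :: real and m :: nat
  assume c: "c > 0" and \<delta>: "\<delta> > 0"
  \<comment> \<open>There will be \<open>k\<close> blocks of mass about \<open>c / k\<close>. The
    one block that may be met fully costs at most \<open>2 * c / k\<close>, which this choice makes
    less than \<open>\<delta> / 2\<close>; the remaining blocks share the other half.\<close>
  obtain k :: nat where k: "k > 4 * c / \<delta>"
    using reals_Archimedean2 by blast
  then have k0: "k > 0"
  proof -
    have "4 * c / \<delta> > 0"
      using c \<delta> by simp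
    with k have "real k > 0"
      by linarith
    then show ?thesis
      by simp
  qed
  define c' \<delta>' where "c' = c / k" and "\<delta>' = \<delta> / (2 * k)"
  have c': "c' > 0" and \<delta>': "\<delta>' > 0"
    using c \<delta> k0 by (auto simp: c'_def \<delta>'_def)
  \<comment> \<open>\<open>E\<close> is the union of the first \<open>j\<close> blocks. In the last
    bound, \<open>2 * c'\<close> pays for the first block that \<open>F\<close> touches and
    \<open>j * \<delta>'\<close> for the later ones.\<close>
  have "\<exists>E. finite E \<and> E \<subseteq> {m..} \<and> E \<inter> s = {} \<and> j * c' \<le> sum w E \<and> sum w E \<le> 2 * (j * c') \<and>
      (\<forall>F\<in>\<U>. sum w (F \<inter> E) \<le> j * \<delta>') \<and>
      (\<forall>F. s \<union> F \<in> \<F> \<longrightarrow> sum w (F \<inter> E) \<le> 2 * c' + j * \<delta>')" for j :: nat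
  proof (induction j)
    case 0
    show ?case
      using c' by (intro exI[of _ "{}"]) auto
  next
    case (Suc j)
    then obtain E where E: "finite E" "E \<subseteq> {m..}" "E \<inter> s = {}"
      "j * c' \<le> sum w E" "sum w E \<le> 2 * (j * c')"
      and EU: "\<And>F. F \<in> \<U> \<Longrightarrow> sum w (F \<inter> E) \<le> j * \<delta>'"
      and Es: "\<And>F. s \<union> F \<in> \<F> \<Longrightarrow> sum w (F \<inter> E) \<le> 2 * c' + j * \<delta>'"
      by blast
    obtain p where p: "\<And>x. x \<in> E \<union> s \<union> {m} \<Longrightarrow> x < p"
      using finite_nat_set_iff_bounded[of "E \<union> s \<union> {m}"] E(1) \<open>finite s\<close> by auto
    \<comment> \<open>One application of \<open>step\<close> for each of the finitely many points of
      \<open>E\<close>; these lie outside \<open>s\<close> by the invariant.\<close>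
    have "evadable w (\<U> \<union> (\<Union>n\<in>E. {F. insert n s \<union> F \<in> \<F>}))"
      using E by (intro evadable_Un_UN U step) auto
    from evadableE[OF this c' \<delta>', of p] obtain D
      where D: "finite D" "D \<subseteq> {p..}" "c' \<le> sum w D" "sum w D \<le> 2 * c'"
        and D\<delta>: "\<And>F. F \<in> \<U> \<union> (\<Union>n\<in>E. {F. insert n s \<union> F \<in> \<F>}) \<Longrightarrow> sum w (F \<inter> D) \<le> \<delta>'"
      by blast
    have disj: "E \<inter> D = {}" and Ds: "D \<inter> s = {}" and Dm: "D \<subseteq> {m..}"
      using p D(2) by fastforce+
    have sum_split: "sum w (F \<inter> (E \<union> D)) = sum w (F \<inter> E) + sum w (F \<inter> D)" for F
      using E(1) D(1) disj by (subst Int_Un_distrib, subst sum.union_disjoint) auto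
    have "sum w (F \<inter> (E \<union> D)) \<le> 2 * c' + Suc j * \<delta>'" if F: "s \<union> F \<in> \<F>" for F
    \<comment> \<open>If \<open>F\<close> misses all earlier blocks, the full mass of
      \<open>D\<close> is affordable. Otherwise a point \<open>n\<close> of \<open>F\<close> in
      \<open>E\<close> puts \<open>F\<close> into one of the families that \<open>D\<close>
      evades.\<close>
    proof (cases "F \<inter> E = {}")
      case True
      have "sum w (F \<inter> D) \<le> sum w D"
        using D(1) nonneg by (intro sum_mono2) auto
      then have "sum w (F \<inter> D) \<le> 2 * c'"
        using D(4) by linarith
      moreover have "0 \<le> Suc j * \<delta>'"
        using \<delta>' by simp
      ultimately show ?thesis
        using True by (simp add: sum_split del: of_nat_Suc)
    next
      case False
      then obtain n where n: "n \<in> F" "n \<in> E"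
        by blast
      then have "insert n s \<union> F = s \<union> F"
        by blast
      with F have "insert n s \<union> F \<in> \<F>"
        by simp
      with n have "sum w (F \<inter> D) \<le> \<delta>'"
        by (intro D\<delta>) blast
      then show ?thesis
        using Es[OF F] by (simp add: sum_split algebra_simps)
    qed
    moreover have "sum w (F \<inter> (E \<union> D)) \<le> Suc j * \<delta>'" if "F \<in> \<U>" for F
      using EU[OF that] D\<delta>[of F] that by (simp add: sum_split algebra_simps)
    moreover have "sum w (E \<union> D) = sum w E + sum w D"
      using E(1) D(1) disj by (rule sum.union_disjoint)
    then have "Suc j * c' \<le> sum w (E \<union> D)" "sum w (E \<union> D) \<le> 2 * (Suc j * c')"
      using E(4,5) D(3,4) by (auto simp: algebra_simps)
    ultimately show ?case
      using E D(1) Ds Dm by (intro exI[of _ "E \<union> D"]) auto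
  qed
  from this[of k] obtain E where E: "finite E" "E \<subseteq> {m..}" "k * c' \<le> sum w E" "sum w E \<le> 2 * (k * c')"
      "\<forall>F\<in>\<U>. sum w (F \<inter> E) \<le> k * \<delta>'" "\<forall>F. s \<union> F \<in> \<F> \<longrightarrow> sum w (F \<inter> E) \<le> 2 * c' + k * \<delta>'"
    by blast
  have "k * c' = c" "k * \<delta>' = \<delta> / 2" "2 * c' \<le> \<delta> / 2"
    using k k0 c \<delta> by (auto simp: c'_def \<delta>'_def field_simps)
  with E \<delta> show "\<exists>E. finite E \<and> E \<subseteq> {m..} \<and> c \<le> sum w E \<and> sum w E \<le> 2 * c \<and>
      (\<forall>F\<in>\<U> \<union> {F. s \<union> F \<in> \<F>}. sum w (F \<inter> E) \<le> \<delta>)"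
    by (intro exI[of _ E]) fastforce
qed

section \<open>Compactness and well-foundedness\<close>

lemma openin_powerset_topology_notin: "openin powerset_topology {B. n \<notin> B}"
proof -
  let ?X = "product_topology (\<lambda>_. discrete_topology (UNIV :: bool set)) (UNIV :: nat set)"
  have "openin ?X {f \<in> topspace ?X. f n \<in> {False}}"
    by (rule openin_continuous_map_preimage[OF continuous_map_product_projection]) auto
  then show ?thesis
    unfolding powerset_topology_def openin_pullback_topology
    by (intro exI[of _ "{f \<in> topspace ?X. f n \<in> {False}}"]) auto
qed

text \<open>Otherwise the open sets \<open>{B. n \<notin> B}\<close> with \<open>n \<in> A\<close>
  cover \<open>\<F>\<close>. A finite subcover is indexed by a finite
  \<open>B \<subseteq> A\<close>, yet it misses \<open>B\<close> itself, which lies in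
  \<open>\<F>\<close>.\<close>

lemma compactin_powerset_topology_superset:
  assumes "compactin powerset_topology \<F>"
    and fin: "\<And>B. finite B \<Longrightarrow> B \<subseteq> A \<Longrightarrow> B \<in> \<F>"
  shows "\<exists>B\<in>\<F>. A \<subseteq> B"
proof (rule ccontr)
  assume "\<not> (\<exists>B\<in>\<F>. A \<subseteq> B)"
  then have "\<F> \<subseteq> \<Union> ((\<lambda>n. {B. n \<notin> B}) ` A)"
    by blast
  moreover have "\<forall>U\<in>(\<lambda>n. {B. n \<notin> B}) ` A. openin powerset_topology U"
    using openin_powerset_topology_notin by blast
  ultimately have "\<exists>C. finite C \<and> C \<subseteq> (\<lambda>n. {B. n \<notin> B}) ` A \<and> \<F> \<subseteq> \<Union> C"
    using assms(1) unfolding compactin_def by simp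
  then obtain C where C: "finite C" "C \<subseteq> (\<lambda>n. {B. n \<notin> B}) ` A" "\<F> \<subseteq> \<Union> C"
    by (elim exE conjE)
  then obtain B where "finite B" "B \<subseteq> A" "C = (\<lambda>n. {B. n \<notin> B}) ` B"
    by (meson finite_subset_image)
  with C(3) fin[of B] show False
    by auto
qed

text \<open>Larger sets count as smaller, so induction passes from the one-point extensions of
  \<open>s\<close> to \<open>s\<close>. Along an infinite chain, heredity puts every finite subset
  of the union into \<open>\<F>\<close>, so compactness yields a member containing the union, which
  is infinite.\<close>

lemma wf_one_point_extension:
  assumes "compactin powerset_topology \<F>" "hereditary \<F>" "\<forall>F\<in>\<F>. finite F"
  shows "wf {(insert n s, s) | n s. n \<notin> s \<and> insert n s \<in> \<F>}"
  unfolding wf_iff_no_infinite_down_chain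
proof
  assume "\<exists>f. \<forall>i. (f (Suc i), f i) \<in> {(insert n s, s) | n s. n \<notin> s \<and> insert n s \<in> \<F>}"
  then obtain f where chain: "\<forall>i. (f (Suc i), f i) \<in> {(insert n s, s) | n s. n \<notin> s \<and> insert n s \<in> \<F>}"
    by (rule exE)
  have f: "\<exists>n. f (Suc i) = insert n (f i) \<and> n \<notin> f i \<and> f (Suc i) \<in> \<F>" for i
    using chain[rule_format, of i] by auto
  \<comment> \<open>The relation asserts membership only of the extended set; heredity covers
    \<open>f 0\<close> as well.\<close>
  have mem: "f i \<in> \<F>" for i
    using f[of i] assms(2) unfolding hereditary_def by (metis subset_insertI)
  have mono: "f i \<subseteq> f j" if "i \<le> j" for i j
    using lift_Suc_mono_le[of f i j] that f by (metis subset_insertI)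
  have card: "i \<le> card (f i)" for i
  proof (induction i)
    case (Suc i)
    then show ?case
      using f[of i] mem[of i] assms(3) by auto
  qed simp
  have "B \<in> \<F>" if "finite B" "B \<subseteq> (\<Union>i. f i)" for B
  proof -
    have "\<exists>i. B \<subseteq> f i"
      using that
    proof (induction B rule: finite_induct)
      case (insert b B)
      then obtain i j where "B \<subseteq> f i" "b \<in> f j"
        by auto
      then have "insert b B \<subseteq> f (max i j)"
        using mono[of i "max i j"] mono[of j "max i j"] by auto
      then show ?case ..
    qed simp
    then show ?thesis
      using mem assms(2) unfolding hereditary_def by blast
  qed
  with compactin_powerset_topology_superset[OF assms(1)]
  obtain B where B: "B \<in> \<F>" "(\<Union>i. f i) \<subseteq> B"
    by meson
  then have "card (f (Suc (card B))) \<le> card B"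
    using assms(3) by (intro card_mono) auto
  with card[of "Suc (card B)"] show False
    by simp
qed

section \<open>Evadability of compact families and the contradiction\<close>

lemma evadable_compact:
  fixes w :: "nat \<Rightarrow> real"
  assumes "\<And>n. 0 \<le> w n" "w \<longlonglongrightarrow> 0" "\<not> summable w"
    and "compactin powerset_topology \<F>" "hereditary \<F>" "\<forall>F\<in>\<F>. finite F"
  shows "evadable w \<F>"
proof -
  \<comment> \<open>The claim ranges over all \<open>\<U>\<close> because the inductive step adjoins
    several families in succession.\<close>
  have "finite s \<longrightarrow> (\<forall>\<U>. evadable w \<U> \<longrightarrow> evadable w (\<U> \<union> {F. s \<union> F \<in> \<F>}))" for s
    using wf_one_point_extension[OF assms(4-6)]
  proof (induction s rule: wf_induct_rule)
    case (less s)
    show ?case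
    proof (intro impI allI)
      fix \<U> assume s: "finite s" and U: "evadable w \<U>"
      show "evadable w (\<U> \<union> {F. s \<union> F \<in> \<F>})"
      proof (rule evadable_Un_extensions[OF assms(1) s U])
        fix n \<V> assume n: "n \<notin> s" and V: "evadable w \<V>"
        show "evadable w (\<V> \<union> {F. insert n s \<union> F \<in> \<F>})"
        proof (cases "insert n s \<in> \<F>")
          case True
          with n have "(insert n s, s) \<in> {(insert n s, s) | n s. n \<notin> s \<and> insert n s \<in> \<F>}"
            by auto
          from less[OF this] s V show ?thesis
            by simp
        next
          \<comment> \<open>By heredity, no set containing \<open>insert n s\<close> lies in
            \<open>\<F>\<close>, so nothing is adjoined. Sets \<open>s\<close> without extensions in
            \<open>\<F>\<close> are handled this way, with no separate base case.\<close>
          case False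
          then have "{F. insert n s \<union> F \<in> \<F>} = {}"
            using assms(5) unfolding hereditary_def by blast
          with V show ?thesis
            by (simp only: Un_empty_right)
        qed
      qed
    qed
  qed
  \<comment> \<open>For \<open>s = {}\<close> the adjoined family is \<open>\<F>\<close> itself,
    added to the empty family.\<close>
  from this[of "{}"] evadable_empty[OF assms(1-3)] show ?thesis
    by fastforce
qed

theorem theorem7p2:
  fixes \<mu> :: "nat measure" and \<F> :: "nat set set" and \<epsilon> :: real
  assumes "measure_on_omega \<mu>"
    and "emeasure \<mu> UNIV = \<infinity>"
    and "(\<lambda>n. emeasure \<mu> {n}) \<longlonglongrightarrow> 0"
    and "hereditary \<F>"
    and "\<forall>F\<in>\<F>. finite F"
    and "\<epsilon> > 0"
    and "\<forall>E. finite E \<longrightarrow> (\<exists>F\<in>\<F>. F \<subseteq> E \<and> emeasure \<mu> F \<ge> ennreal \<epsilon> * emeasure \<mu> E)"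
  shows "\<not> compactin powerset_topology \<F>"
proof
  assume compact: "compactin powerset_topology \<F>"
  define w where "w n = measure \<mu> {n}" for n
  have sets: "sets \<mu> = UNIV" and fin: "emeasure \<mu> {n} < \<infinity>" for n
    using assms(1) by (auto simp: measure_on_omega_def)
  have w: "emeasure \<mu> {n} = ennreal (w n)" for n
    unfolding w_def using fin[of n] by (intro emeasure_eq_ennreal_measure) auto
  have nonneg: "0 \<le> w n" for n
    by (simp add: w_def)
  have emeasure_finite: "emeasure \<mu> A = ennreal (sum w A)" if "finite A" for A
    using that by (subst emeasure_eq_sum_singleton) (auto simp: sets w nonneg sum_ennreal)
  have "w \<longlonglongrightarrow> 0"
    using assms(3) nonneg by (simp add: w tendsto_ennreal_iff flip: ennreal_0)
  moreover have "\<not> summable w"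
  proof
    assume "summable w"
    then have "(\<Sum>n. ennreal (w n)) \<noteq> \<infinity>"
      by (simp add: suminf_ennreal2 nonneg)
    moreover have "emeasure \<mu> UNIV = (\<Sum>n. ennreal (w n))"
      by (subst emeasure_countable_singleton) (auto simp: sets w nn_integral_count_space_nat)
    ultimately show False
      using assms(2) by simp
  qed
  ultimately have "evadable w \<F>"
    using nonneg compact assms(4,5) by (intro evadable_compact) auto
  moreover have "\<epsilon> / 2 > 0"
    using assms(6) by simp
  \<comment> \<open>At scale 1, members of \<open>\<F>\<close> inside \<open>E\<close> have mass at
    most \<open>\<epsilon> / 2\<close>, while the hypothesis on \<open>\<F>\<close> demands one of
    mass at least \<open>\<epsilon>\<close>.\<close>
  ultimately obtain E where E: "finite E" "1 \<le> sum w E" "\<And>F. F \<in> \<F> \<Longrightarrow> sum w (F \<inter> E) \<le> \<epsilon> / 2"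
    using evadableE[OF _ zero_less_one] by metis
  then obtain F where F: "F \<in> \<F>" "F \<subseteq> E" "ennreal \<epsilon> * emeasure \<mu> E \<le> emeasure \<mu> F"
    using assms(7) by blast
  have "ennreal (\<epsilon> * sum w E) \<le> ennreal (sum w F)"
    using F E(1) assms(6)
    by (simp add: emeasure_finite finite_subset[OF F(2)] ennreal_mult' sum_nonneg nonneg)
  then have "\<epsilon> * sum w E \<le> sum w F"
    by (simp add: sum_nonneg nonneg)
  moreover have "\<epsilon> * 1 \<le> \<epsilon> * sum w E"
    using E(2) assms(6) by (intro mult_left_mono) auto
  moreover have "sum w F \<le> \<epsilon> / 2"
    using E(3)[OF F(1)] F(2) by (simp add: Int_absorb2)
  ultimately show False
    using assms(6) by simp
qed

end
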